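(* Let $\zeta_1,\ldots,\zeta_n$ be i.i.d. real random variables, let $S_i=\sum_{j=1}^i\zeta_j$ for $i=0,\ldots,n$, and let $B\subseteq\mathbb{R}$ be a Borel set with $\mathbb{P}(S_n\in B)>0$. Let $\sigma=\max\{i\le n: S_i\le 0\}$. Then for the random walk $(S_i)_{i=0,\ldots,n}$ conditioned on $\{S_n\in B\}$ (i.e. under $\mathbb{P}(\,\cdot\mid S_n\in B)$) the following hold: (1) the process $\hat S=(\hat S_i)_{i=0,\ldots,\sigma}$ has the same law as $S$ considered up to $\sigma$, i.e. as $(S_i)_{i=0,\ldots,\sigma}$; (2) $N^-,\ \tilde N^+,\ \overrightarrow{F},\ \overleftarrow{G}$ have the same distribution; (3) $N^+,\ \tilde N^-,\ \overleftarrow{F},\ \overrightarrow{G}$ have the same distribution.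
   Context: $S_0=0$, so $\sigma\in\{0,\ldots,n\}$ is well defined. Let $\underline{S}=\min\{S_i: i\le\sigma\}$ and $\overline{S}=\max\{S_i: i\le\sigma\}$, where indices $i$ range over non-negative integers. Define $$N^-=\sum_{i=1}^{\sigma}\mathbf{1}_{\{S_i\le 0\}},\qquad N^+=\sum_{i=1}^{\sigma}\mathbf{1}_{\{S_i\ge 0\}},$$ $$\tilde N^-=\sum_{i=0}^{\sigma-1}\mathbf{1}_{\{S_i\le S_\sigma\}},\qquad \tilde N^+=\sum_{i=0}^{\sigma-1}\mathbf{1}_{\{S_i\ge S_\sigma\}},$$ $$\overrightarrow{F}=\max\{i\le\sigma: S_i=\underline{S}\},\qquad \overrightarrow{G}=\max\{i\le\sigma: S_i=\overline{S}\},$$ $$\overleftarrow{F}=\sigma-\min\{i\le\sigma: S_i=\underline{S}\},\qquad \overleftarrow{G}=\sigma-\min\{i\le\sigma: S_i=\overline{S}\}.$$ The process $\hat S$ is $-S$ time-reversed at $\sigma$: $\hat S_i=S_\sigma-S_{\sigma-i}$ for $i=0,\ldots,\sigma$. Empty sums are $0$. *)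

theory Defs
  imports "HOL-Probability.Probability"
begin

definition walk :: "(nat \<Rightarrow> 'a \<Rightarrow> real) \<Rightarrow> 'a \<Rightarrow> nat \<Rightarrow> real" where
  "walk \<zeta> \<omega> i = (\<Sum>j=1..i. \<zeta> j \<omega>)"

text \<open>The functionals below take the horizon \<open>n\<close> and a path \<open>s\<close> with \<open>s 0 = 0\<close>, so that
  the set in \<open>last_nonpos\<close> contains \<open>0\<close>; only the values \<open>s 0, \<dots>, s n\<close> matter.\<close>

definition last_nonpos :: "nat \<Rightarrow> (nat \<Rightarrow> real) \<Rightarrow> nat" where
  "last_nonpos n s = Max {i. i \<le> n \<and> s i \<le> 0}"

definition run_min :: "nat \<Rightarrow> (nat \<Rightarrow> real) \<Rightarrow> real" where
  "run_min n s = Min {s i | i. i \<le> last_nonpos n s}"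

definition run_max :: "nat \<Rightarrow> (nat \<Rightarrow> real) \<Rightarrow> real" where
  "run_max n s = Max {s i | i. i \<le> last_nonpos n s}"

definition N_minus :: "nat \<Rightarrow> (nat \<Rightarrow> real) \<Rightarrow> nat" where
  "N_minus n s = (\<Sum>i=1..last_nonpos n s. of_bool (s i \<le> 0))"

definition N_plus :: "nat \<Rightarrow> (nat \<Rightarrow> real) \<Rightarrow> nat" where
  "N_plus n s = (\<Sum>i=1..last_nonpos n s. of_bool (s i \<ge> 0))"

definition Nt_minus :: "nat \<Rightarrow> (nat \<Rightarrow> real) \<Rightarrow> nat" where
  "Nt_minus n s = (\<Sum>i<last_nonpos n s. of_bool (s i \<le> s (last_nonpos n s)))"

definition Nt_plus :: "nat \<Rightarrow> (nat \<Rightarrow> real) \<Rightarrow> nat" where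
  "Nt_plus n s = (\<Sum>i<last_nonpos n s. of_bool (s i \<ge> s (last_nonpos n s)))"

definition F_right :: "nat \<Rightarrow> (nat \<Rightarrow> real) \<Rightarrow> nat" where
  "F_right n s = Max {i. i \<le> last_nonpos n s \<and> s i = run_min n s}"

definition G_right :: "nat \<Rightarrow> (nat \<Rightarrow> real) \<Rightarrow> nat" where
  "G_right n s = Max {i. i \<le> last_nonpos n s \<and> s i = run_max n s}"

text \<open>The subtractions of naturals do not truncate: the subtracted minimum is at most
  \<open>last_nonpos n s\<close>.\<close>

definition F_left :: "nat \<Rightarrow> (nat \<Rightarrow> real) \<Rightarrow> nat" where
  "F_left n s = last_nonpos n s - Min {i. i \<le> last_nonpos n s \<and> s i = run_min n s}"

definition G_left :: "nat \<Rightarrow> (nat \<Rightarrow> real) \<Rightarrow> nat" where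
  "G_left n s = last_nonpos n s - Min {i. i \<le> last_nonpos n s \<and> s i = run_max n s}"

text \<open>Only evaluated at \<open>i \<le> last_nonpos n s\<close>.\<close>

definition reversed :: "nat \<Rightarrow> (nat \<Rightarrow> real) \<Rightarrow> nat \<Rightarrow> real" where
  "reversed n s i = s (last_nonpos n s) - s (last_nonpos n s - i)"

text \<open>A finite path \<open>s 0, \<dots>, s k\<close> of variable length is encoded by its last index \<open>k\<close> and
  the function \<open>s\<close> restricted to \<open>{..k}\<close>, which has the fixed value \<open>undefined\<close> elsewhere. On
  the set of these codes \<open>path_space\<close> induces the sigma-algebra of the disjoint union of
  the spaces of real sequences indexed by \<open>{..k}\<close>.\<close>

definition path_upto :: "nat \<Rightarrow> (nat \<Rightarrow> real) \<Rightarrow> nat \<times> (nat \<Rightarrow> real)" where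
  "path_upto k s = (k, restrict s {..k})"

definition path_space :: "(nat \<times> (nat \<Rightarrow> real)) measure" where
  "path_space = count_space UNIV \<Otimes>\<^sub>M (\<Pi>\<^sub>M i\<in>UNIV. borel)"

end

theory Submission
  imports Defs
begin

text \<open>
  The event that \<open>\<sigma> = k\<close> and \<open>S\<^sub>n \<in> B\<close> says that \<open>S\<^sub>k \<le> 0\<close>, that \<open>S\<^sub>i > 0\<close> for \<open>k < i \<le> n\<close>, and that
  \<open>S\<^sub>n \<in> B\<close>. None of this changes when the first \<open>k\<close> increments are permuted among themselves.
  Hence, conditionally on the event, these increments are still exchangeable, and the random time
  \<open>\<sigma>\<close> can be replaced by the deterministic horizon \<open>k\<close>. Two functionals of the path up to \<open>k\<close>
  then have the same conditional law as soon as, for any \<open>k\<close> fixed increments, they take their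
  values equally often when the increments are put into all \<open>k!\<close> orders
  (\<open>equally_often\<close>, \<open>conditional_law_eq\<close>). The claims become combinatorial statements about
  orderings.

  Reversing the order of the increments is a bijection of the orderings, and turns the path
  into \<open>i \<mapsto> s k - s (k - i)\<close>; this gives the equality in law of the reversed process with the
  original one (\<open>equally_often_rev_path\<close>).

  All eight functionals are obtained from only two, the number of indices \<open>i \<in> {1..k}\<close>
  with \<open>s i \<le> 0\<close> and the last time at which the minimum over \<open>{0..k}\<close> is attained, evaluated at the
  path, its reversal, its negative or its negated reversal (\<open>functionals_at_last_nonpos\<close>).
  So besides reversal only the equivalence principle of Sparre Andersen is needed:
  over all orderings of given increments these two functionals have the same distribution
  (\<open>equally_often_nonpos_time_last_argmin\<close>). It is witnessed by an explicit rearrangement that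
  inspects the sign of the total sum. If the total is nonpositive, then the last index is
  counted, so removing the last increment lowers the count by one; correspondingly, removing the
  \<^emph>\<open>first\<close> increment lowers the last argmin by one, because the minimum is then
  already attained at a positive time. If the total is positive, then removing the last increment
  changes neither quantity. The rearrangement therefore moves the last increment to the front in
  the first case, leaves it at the end in the second, and treats the remaining ones recursively;
  it is injective since the total, hence the case, can be read off from the result.
\<close>

section \<open>Path functionals at a deterministic horizon\<close>

definition nonpos_time :: "nat \<Rightarrow> (nat \<Rightarrow> real) \<Rightarrow> nat" where
  "nonpos_time k s = card {i \<in> {1..k}. s i \<le> 0}"

definition argmin_set :: "nat \<Rightarrow> (nat \<Rightarrow> real) \<Rightarrow> nat set" where
  "argmin_set k s = {i. i \<le> k \<and> (\<forall>j\<le>k. s i \<le> s j)}"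

definition last_argmin :: "nat \<Rightarrow> (nat \<Rightarrow> real) \<Rightarrow> nat" where
  "last_argmin k s = Max (argmin_set k s)"

definition rev_path :: "nat \<Rightarrow> (nat \<Rightarrow> real) \<Rightarrow> nat \<Rightarrow> real" where
  "rev_path k s i = s k - s (k - i)"

text \<open>The first argument of a functional is the horizon. Paths are functions on all
  of \<open>nat\<close>, of which only an initial segment is meaningful, so independence of the later values has
  to be stated.\<close>
definition horizon_local :: "(nat \<Rightarrow> (nat \<Rightarrow> real) \<Rightarrow> 'b) \<Rightarrow> bool" where
  "horizon_local f \<longleftrightarrow> (\<forall>k s t. (\<forall>i\<le>k. s i = t i) \<longrightarrow> f k s = f k t)"

lemma horizon_localD: "horizon_local f \<Longrightarrow> (\<And>i. i \<le> k \<Longrightarrow> s i = t i) \<Longrightarrow> f k s = f k t"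
  unfolding horizon_local_def by blast

lemma horizon_local_nonpos_time: "horizon_local nonpos_time"
  unfolding horizon_local_def nonpos_time_def by (auto intro!: arg_cong[where f = card])

lemma horizon_local_last_argmin: "horizon_local last_argmin"
  unfolding horizon_local_def last_argmin_def argmin_set_def
  by (auto intro!: arg_cong[where f = Max])

lemma horizon_local_path_upto: "horizon_local path_upto"
  unfolding horizon_local_def path_upto_def by (auto simp: restrict_def)

lemma horizon_local_uminus: "horizon_local f \<Longrightarrow> horizon_local (\<lambda>k s. f k (\<lambda>i. - s i))"
  unfolding horizon_local_def by simp

lemma horizon_local_rev_path: "horizon_local f \<Longrightarrow> horizon_local (\<lambda>k s. f k (rev_path k s))"
  unfolding horizon_local_def rev_path_def by simp

lemma finite_argmin_set: "finite (argmin_set k s)"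
  unfolding argmin_set_def by simp

lemma argmin_set_nonempty: "argmin_set k s \<noteq> {}"
proof -
  have "Min (s ` {..k}) \<in> s ` {..k}" by (intro Min_in) auto
  then obtain i where "i \<le> k" "s i = Min (s ` {..k})" by (metis imageE atMost_iff)
  then have "i \<in> argmin_set k s" by (auto simp: argmin_set_def)
  then show ?thesis by blast
qed

lemma last_argmin_in: "last_argmin k s \<in> argmin_set k s"
  unfolding last_argmin_def by (intro Max_in finite_argmin_set argmin_set_nonempty)

lemma last_argmin_eqI:
  assumes "r \<le> k" "\<And>i. i \<le> k \<Longrightarrow> s r \<le> s i" "\<And>i. r < i \<Longrightarrow> i \<le> k \<Longrightarrow> s r < s i"
  shows "last_argmin k s = r"
  unfolding last_argmin_def
proof (rule Max_eqI)
  show "r \<in> argmin_set k s" using assms(1,2) by (auto simp: argmin_set_def)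
  fix i assume "i \<in> argmin_set k s"
  then have "i \<le> k" "s i \<le> s r" using assms(1) by (auto simp: argmin_set_def)
  then show "i \<le> r" using assms(3)[of i] by (meson leD leI)
qed (rule finite_argmin_set)

lemma last_argmin_less:
  assumes "last_argmin k s < i" "i \<le> k"
  shows "s (last_argmin k s) < s i"
proof (rule ccontr)
  assume "\<not> ?thesis"
  then have "i \<in> argmin_set k s"
    using last_argmin_in[of k s] assms by (force simp: argmin_set_def)
  then have "i \<le> last_argmin k s"
    unfolding last_argmin_def by (intro Max_ge finite_argmin_set)
  with assms show False by simp
qed

lemma last_argmin_le: "i \<le> k \<Longrightarrow> s (last_argmin k s) \<le> s i" "last_argmin k s \<le> k"
  using last_argmin_in[of k s] by (auto simp: argmin_set_def)

text \<open>The index \<open>i\<close> of the reversed and negated path corresponds to the index \<open>k - i\<close> of the path, with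
  values that differ by the constant \<open>s k\<close>. Thus minima stay minima, and first becomes last.\<close>
lemma horizon_minus_first_argmin:
  "k - Min (argmin_set k s) = last_argmin k (\<lambda>i. - rev_path k s i)"
proof -
  let ?m = "Min (argmin_set k s)"
  have m: "?m \<in> argmin_set k s" by (intro Min_in finite_argmin_set argmin_set_nonempty)
  have first: "s ?m < s j" if "j < ?m" for j
  proof (rule ccontr)
    assume "\<not> ?thesis"
    then have "j \<in> argmin_set k s" using m that by (force simp: argmin_set_def)
    then have "?m \<le> j" by (intro Min_le finite_argmin_set)
    with that show False by simp
  qed
  have "?m \<le> k" "\<And>j. j \<le> k \<Longrightarrow> s ?m \<le> s j" using m by (auto simp: argmin_set_def)
  then show ?thesis
    by (intro last_argmin_eqI[symmetric]) (auto simp: rev_path_def intro!: first)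
qed

lemma argmin_set_eq_run_min: "{i. i \<le> last_nonpos n s \<and> s i = run_min n s} = argmin_set (last_nonpos n s) s"
proof -
  define k where "k = last_nonpos n s"
  have eq: "run_min n s = Min (s ` {..k})"
    unfolding run_min_def k_def by (rule arg_cong[where f = Min]) auto
  have "s i = Min (s ` {..k}) \<longleftrightarrow> (\<forall>j\<le>k. s i \<le> s j)" if "i \<le> k" for i
    using that by (subst eq_commute, subst Min_eq_iff) auto
  then show ?thesis unfolding argmin_set_def eq k_def[symmetric] by auto
qed

lemma argmin_set_eq_run_max:
  "{i. i \<le> last_nonpos n s \<and> s i = run_max n s} = argmin_set (last_nonpos n s) (\<lambda>i. - s i)"
proof -
  define k where "k = last_nonpos n s"
  have eq: "run_max n s = Max (s ` {..k})"
    unfolding run_max_def k_def by (rule arg_cong[where f = Max]) auto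
  have "s i = Max (s ` {..k}) \<longleftrightarrow> (\<forall>j\<le>k. s j \<le> s i)" if "i \<le> k" for i
    using that by (subst eq_commute, subst Max_eq_iff) auto
  then show ?thesis unfolding argmin_set_def eq k_def[symmetric] by auto
qed

text \<open>The reduction of the eight functionals to two. A comparison of \<open>s i\<close> with the final value \<open>s k\<close> is a
  comparison of the reversed path with \<open>0\<close>; a maximum is a minimum of the negative.\<close>
lemma functionals_at_last_nonpos:
  fixes n :: nat and s :: "nat \<Rightarrow> real"
  defines "k \<equiv> last_nonpos n s"
  shows "N_minus n s = nonpos_time k s"
    and "N_plus n s = nonpos_time k (\<lambda>i. - s i)"
    and "Nt_plus n s = nonpos_time k (rev_path k s)"
    and "Nt_minus n s = nonpos_time k (\<lambda>i. - rev_path k s i)"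
    and "F_right n s = last_argmin k s"
    and "G_right n s = last_argmin k (\<lambda>i. - s i)"
    and "F_left n s = last_argmin k (\<lambda>i. - rev_path k s i)"
    and "G_left n s = last_argmin k (rev_path k s)"
proof -
  have count: "(\<Sum>i=1..k. of_bool (P i)) = card {i \<in> {1..k}. P i}" for P :: "nat \<Rightarrow> bool"
    by (simp add: sum_of_bool_eq Int_def)
  have reindex: "(\<Sum>i<k. of_bool (P i)) = (\<Sum>i=1..k. of_bool (P (k - i)) :: nat)"
    for P :: "nat \<Rightarrow> bool"
    by (rule sum.reindex_bij_witness[of _ "\<lambda>i. k - i" "\<lambda>i. k - i"]) auto
  show "N_minus n s = nonpos_time k s"
    unfolding N_minus_def nonpos_time_def k_def[symmetric] count ..
  show "N_plus n s = nonpos_time k (\<lambda>i. - s i)"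
    unfolding N_plus_def nonpos_time_def k_def[symmetric] count by simp
  show "Nt_plus n s = nonpos_time k (rev_path k s)"
    unfolding Nt_plus_def nonpos_time_def k_def[symmetric] reindex count by (simp add: rev_path_def)
  show "Nt_minus n s = nonpos_time k (\<lambda>i. - rev_path k s i)"
    unfolding Nt_minus_def nonpos_time_def k_def[symmetric] reindex count by (simp add: rev_path_def)
  show "F_right n s = last_argmin k s"
    unfolding F_right_def argmin_set_eq_run_min last_argmin_def k_def ..
  show "G_right n s = last_argmin k (\<lambda>i. - s i)"
    unfolding G_right_def argmin_set_eq_run_max last_argmin_def k_def ..
  show "F_left n s = last_argmin k (\<lambda>i. - rev_path k s i)"
    unfolding F_left_def argmin_set_eq_run_min horizon_minus_first_argmin k_def ..
  show "G_left n s = last_argmin k (rev_path k s)"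
    unfolding G_left_def argmin_set_eq_run_max horizon_minus_first_argmin k_def
    by (simp add: rev_path_def[abs_def])
qed

section \<open>The Sparre Andersen rearrangement\<close>

text \<open>The path with a given finite list of increments.\<close>
definition list_path :: "real list \<Rightarrow> nat \<Rightarrow> real" where
  "list_path xs i = sum_list (take i xs)"

text \<open>The argument lists the labels of the increments in reverse order of time, so that the last
  increment of the walk is the head; the result is in order of time. Labels are kept separate
  from the increments \<open>w\<close> because equal increments have to be distinguished when orderings are
  counted.\<close>
primrec rearrange :: "('b \<Rightarrow> real) \<Rightarrow> 'b list \<Rightarrow> 'b list" where
  "rearrange w [] = []"
| "rearrange w (a # ls) =
    (if sum_list (map w (a # ls)) \<le> 0 then a # rearrange w ls else rearrange w ls @ [a])"

lemma mset_rearrange: "mset (rearrange w ls) = mset ls"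
  by (induction ls) auto

lemma sum_list_rearrange: "sum_list (map w (rearrange w ls)) = sum_list (map w ls)"
  by (induction ls) auto

lemma length_rearrange: "length (rearrange w ls) = length ls"
  by (metis mset_rearrange size_mset)

text \<open>The sum of the increments survives the rearrangement, so two lists with the same result take the
  same branch; then the moved label and the recursive result can be read off.\<close>
lemma rearrange_eq_imp_eq: "rearrange w ls = rearrange w ls' \<Longrightarrow> ls = ls'"
proof (induction ls arbitrary: ls')
  case Nil
  then show ?case by (metis length_0_conv length_rearrange)
next
  case (Cons a ls)
  then obtain b ks where ls': "ls' = b # ks"
    by (metis length_0_conv length_rearrange list.exhaust list.distinct(1))
  have "sum_list (map w (a # ls)) = sum_list (map w ls')"
    by (metis Cons.prems sum_list_rearrange)
  then have "a = b \<and> rearrange w ls = rearrange w ks"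
    using Cons.prems unfolding ls' by (simp split: if_splits)
  then show ?case using Cons.IH ls' by blast
qed

text \<open>Since the path ends at or below its starting value \<open>0\<close>, the minimum over all times is also attained
  at a positive time, and from time \<open>1\<close> on the path is a translate of the one with increments
  \<open>xs\<close>.\<close>
lemma last_argmin_Cons:
  assumes "sum_list (x # xs) \<le> 0"
  shows "last_argmin (Suc (length xs)) (list_path (x # xs)) =
    Suc (last_argmin (length xs) (list_path xs))" (is "_ = Suc ?r")
proof (rule last_argmin_eqI)
  show "Suc ?r \<le> Suc (length xs)" using last_argmin_le(2) by simp
  fix i
  show "list_path (x # xs) (Suc ?r) \<le> list_path (x # xs) i" if "i \<le> Suc (length xs)"
  proof (cases i)
    case 0
    then show ?thesis
      using assms last_argmin_le(1)[of "length xs" "length xs" "list_path xs"]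
      by (simp add: list_path_def)
  next
    case (Suc j)
    then show ?thesis
      using that last_argmin_le(1)[of j "length xs" "list_path xs"] by (simp add: list_path_def)
  qed
  show "list_path (x # xs) (Suc ?r) < list_path (x # xs) i" if "Suc ?r < i" "i \<le> Suc (length xs)"
    using that last_argmin_less[of "length xs" "list_path xs" "i - 1"]
    by (cases i) (auto simp: list_path_def)
qed

text \<open>A final value above the starting value \<open>0\<close> cannot be the minimum.\<close>
lemma last_argmin_snoc:
  assumes "sum_list (xs @ [x]) > 0"
  shows "last_argmin (Suc (length xs)) (list_path (xs @ [x])) =
    last_argmin (length xs) (list_path xs)" (is "_ = ?r")
proof (rule last_argmin_eqI)
  have r: "?r \<le> length xs" by (rule last_argmin_le)
  show "?r \<le> Suc (length xs)" using r by simp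
  have same: "list_path (xs @ [x]) i = list_path xs i" if "i \<le> length xs" for i
    using that by (simp add: list_path_def)
  have neg: "list_path xs ?r \<le> 0"
    using last_argmin_le(1)[of 0 "length xs" "list_path xs"] by (simp add: list_path_def)
  have last: "list_path xs ?r < list_path (xs @ [x]) (Suc (length xs))"
    using assms neg by (simp add: list_path_def)
  fix i
  show "list_path (xs @ [x]) ?r \<le> list_path (xs @ [x]) i" if "i \<le> Suc (length xs)"
    using that last last_argmin_le(1)[of i "length xs" "list_path xs"]
    by (cases "i = Suc (length xs)") (auto simp: same r)
  show "list_path (xs @ [x]) ?r < list_path (xs @ [x]) i" if "?r < i" "i \<le> Suc (length xs)"
    using that last last_argmin_less[of "length xs" "list_path xs" i]
    by (cases "i = Suc (length xs)") (auto simp: same r)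
qed

lemma nonpos_time_snoc:
  "nonpos_time (Suc (length xs)) (list_path (xs @ [x])) =
    nonpos_time (length xs) (list_path xs) + of_bool (sum_list (xs @ [x]) \<le> 0)"
proof -
  have "{i \<in> {1..Suc (length xs)}. list_path (xs @ [x]) i \<le> 0} =
      {i \<in> {1..length xs}. list_path xs i \<le> 0} \<union>
      (if sum_list (xs @ [x]) \<le> 0 then {Suc (length xs)} else {})"
    by (auto simp: list_path_def le_Suc_eq)
  then show ?thesis unfolding nonpos_time_def by (auto simp: card_insert_if)
qed

text \<open>Both sides satisfy the same recursion in the last increment of the walk: they grow by one if
  the total is nonpositive and are unchanged otherwise.\<close>
lemma last_argmin_rearrange:
  "last_argmin (length ls) (list_path (map w (rearrange w ls))) =
    nonpos_time (length ls) (list_path (map w (rev ls)))"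
proof (induction ls)
  case Nil
  then show ?case
    using last_argmin_le(2)[of 0 "list_path []"] by (simp add: nonpos_time_def)
next
  case (Cons a ls)
  have time: "nonpos_time (length (a # ls)) (list_path (map w (rev (a # ls)))) =
      nonpos_time (length ls) (list_path (map w (rev ls))) +
      of_bool (sum_list (map w (a # ls)) \<le> 0)"
    using nonpos_time_snoc[of "map w (rev ls)" "w a"]
    by (simp add: sum_list_rev rev_map add.commute flip: rev_map)
  show ?case
  proof (cases "sum_list (map w (a # ls)) \<le> 0")
    case True
    then show ?thesis
      using time Cons.IH last_argmin_Cons[of "w a" "map w (rearrange w ls)"]
      by (simp add: sum_list_rearrange length_rearrange)
  next
    case False
    then show ?thesis
      using time Cons.IH last_argmin_snoc[of "map w (rearrange w ls)" "w a"]
      by (simp add: sum_list_rearrange length_rearrange add.commute)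
  qed
qed

text \<open>The increments \<open>x 1, \<dots>, x k\<close> are arbitrary and need not be distinct; the count is over
  orderings of their labels.\<close>
definition equally_often ::
  "(nat \<Rightarrow> (nat \<Rightarrow> real) \<Rightarrow> 'b) \<Rightarrow> (nat \<Rightarrow> (nat \<Rightarrow> real) \<Rightarrow> 'b) \<Rightarrow> bool" where
  "equally_often f g \<longleftrightarrow> (\<forall>k (x :: nat \<Rightarrow> real) A.
    card {ls \<in> permutations_of_set {1..k}. f k (list_path (map x ls)) \<in> A} =
    card {ls \<in> permutations_of_set {1..k}. g k (list_path (map x ls)) \<in> A})"

lemma equally_often_trans [trans]:
  "equally_often f g \<Longrightarrow> equally_often g h \<Longrightarrow> equally_often f h"
  unfolding equally_often_def by simp

lemma equally_often_sym: "equally_often f g \<Longrightarrow> equally_often g f"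
  unfolding equally_often_def by simp

text \<open>A self-map of the finite set of orderings that is injective is bijective, and so one that carries
  \<open>f\<close> to \<open>g\<close> matches up the two counts.\<close>
lemma equally_oftenI:
  assumes inj: "\<And>k x. inj_on (\<phi> k x) (permutations_of_set {1..k})"
    and ran: "\<And>k x ls. ls \<in> permutations_of_set {1..k} \<Longrightarrow> \<phi> k x ls \<in> permutations_of_set {1..k}"
    and eq: "\<And>k x ls. ls \<in> permutations_of_set {1..k} \<Longrightarrow>
      g k (list_path (map x (\<phi> k x ls))) = f k (list_path (map x ls))"
  shows "equally_often f g"
  unfolding equally_often_def
proof (intro allI)
  fix k :: nat and x :: "nat \<Rightarrow> real" and A :: "'a set"
  let ?L = "permutations_of_set {1..k}"
  have surj: "\<phi> k x ` ?L = ?L"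
    using inj ran by (intro endo_inj_surj) auto
  have "{ls \<in> ?L. g k (list_path (map x ls)) \<in> A} =
      \<phi> k x ` {ls \<in> ?L. f k (list_path (map x ls)) \<in> A}" (is "?G = _ ` ?F")
  proof
    show "?G \<subseteq> \<phi> k x ` ?F"
    proof
      fix ls assume ls: "ls \<in> ?G"
      then obtain ks where "ks \<in> ?L" "ls = \<phi> k x ks" using surj by blast
      with ls show "ls \<in> \<phi> k x ` ?F" using eq by force
    qed
    show "\<phi> k x ` ?F \<subseteq> ?G" using ran eq by auto
  qed
  then show "card ?F = card ?G"
    using inj_on_subset[OF inj, of ?F] by (simp add: card_image)
qed

text \<open>Sparre Andersen's equivalence principle. The list is reversed because \<open>rearrange\<close> reads it from the
  last increment backwards.\<close>
lemma equally_often_nonpos_time_last_argmin: "equally_often nonpos_time last_argmin"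
proof (rule equally_oftenI[where \<phi> = "\<lambda>k x ls. rearrange x (rev ls)"])
  fix k :: nat and x :: "nat \<Rightarrow> real" and ls :: "nat list"
  show "inj_on (\<lambda>ls. rearrange x (rev ls)) (permutations_of_set {1..k})"
    by (auto intro!: inj_onI dest: rearrange_eq_imp_eq)
  assume ls: "ls \<in> permutations_of_set {1..k}"
  have "mset (rearrange x (rev ls)) = mset ls" by (simp add: mset_rearrange)
  then show "rearrange x (rev ls) \<in> permutations_of_set {1..k}"
    using ls unfolding permutations_of_set_def
    by (metis (mono_tags, lifting) mem_Collect_eq mset_eq_imp_distinct_iff mset_eq_setD)
  have "length (rev ls) = k"
    using length_finite_permutations_of_set[OF ls] by simp
  then show "last_argmin k (list_path (map x (rearrange x (rev ls)))) =
      nonpos_time k (list_path (map x ls))"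
    using last_argmin_rearrange[of "rev ls" x] by simp
qed

lemma list_path_rev:
  assumes "i \<le> length xs"
  shows "list_path (rev xs) i = rev_path (length xs) (list_path xs) i"
proof -
  have "sum_list (take (length xs - i) xs) + sum_list (drop (length xs - i) xs) = sum_list xs"
    by (metis append_take_drop_id sum_list_append)
  then show ?thesis
    by (simp add: list_path_def rev_path_def take_rev sum_list_rev)
qed

lemma equally_often_rev_path:
  assumes "horizon_local f"
  shows "equally_often (\<lambda>k s. f k (rev_path k s)) f"
proof (rule equally_oftenI[where \<phi> = "\<lambda>k x. rev"])
  fix k :: nat and x :: "nat \<Rightarrow> real" and ls :: "nat list"
  show "inj_on rev (permutations_of_set {1..k})" by simp
  assume ls: "ls \<in> permutations_of_set {1..k}"
  then show "rev ls \<in> permutations_of_set {1..k}" by (auto simp: permutations_of_set_def)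
  have "length ls = k"
    using length_finite_permutations_of_set[OF ls] by simp
  then show "f k (list_path (map x (rev ls))) = f k (rev_path k (list_path (map x ls)))"
    using list_path_rev[of _ "map x ls"] by (intro horizon_localD[OF assms]) (auto simp: rev_map)
qed

text \<open>The increments are arbitrary, so they may be replaced by their negatives.\<close>
lemma equally_often_uminus:
  assumes "equally_often f g"
  shows "equally_often (\<lambda>k s. f k (\<lambda>i. - s i)) (\<lambda>k s. g k (\<lambda>i. - s i))"
proof -
  have "(\<lambda>i. - list_path (map x ls) i) = list_path (map (\<lambda>j. - x j) ls)" for x and ls :: "nat list"
    by (simp add: fun_eq_iff list_path_def take_map uminus_sum_list_map o_def)
  then show ?thesis using assms unfolding equally_often_def by simp
qed

section \<open>Measurable path functionals\<close>

text \<open>Measurability refers to the space of paths indexed by \<open>{..k}\<close>. A path given on a longer index set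
  enters it by restriction, which is harmless by locality.\<close>
definition path_functional :: "'b measure \<Rightarrow> (nat \<Rightarrow> (nat \<Rightarrow> real) \<Rightarrow> 'b) \<Rightarrow> bool" where
  "path_functional N f \<longleftrightarrow> horizon_local f \<and> (\<forall>k. f k \<in> (\<Pi>\<^sub>M i\<in>{..k}. borel) \<rightarrow>\<^sub>M N)"

lemma path_functional_local: "path_functional N f \<Longrightarrow> horizon_local f"
  unfolding path_functional_def by blast

lemma measurable_path_functional:
  assumes f: "path_functional N f"
    and s: "\<And>i. i \<le> k \<Longrightarrow> (\<lambda>x. s x i) \<in> borel_measurable P"
  shows "(\<lambda>x. f k (s x)) \<in> P \<rightarrow>\<^sub>M N"
proof -
  have "f k (\<lambda>i\<in>{..k}. s x i) = f k (s x)" for x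
    by (intro horizon_localD[OF path_functional_local[OF f]]) simp
  moreover have "(\<lambda>x. \<lambda>i\<in>{..k}. s x i) \<in> P \<rightarrow>\<^sub>M (\<Pi>\<^sub>M i\<in>{..k}. borel)"
    using s by (intro measurable_restrict) auto
  then have "(\<lambda>x. f k (\<lambda>i\<in>{..k}. s x i)) \<in> P \<rightarrow>\<^sub>M N"
    using f unfolding path_functional_def by (intro measurable_compose[of _ P _ "f k"]) auto
  ultimately show ?thesis by simp
qed

lemma path_functional_uminus:
  assumes "path_functional N f"
  shows "path_functional N (\<lambda>k s. f k (\<lambda>i. - s i))"
  unfolding path_functional_def
  using horizon_local_uminus[OF path_functional_local[OF assms]]
  by (auto intro!: measurable_path_functional[OF assms] borel_measurable_uminus
      measurable_component_singleton)

lemma path_functional_rev_path: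
  assumes "path_functional N f"
  shows "path_functional N (\<lambda>k s. f k (rev_path k s))"
  unfolding path_functional_def
  using horizon_local_rev_path[OF path_functional_local[OF assms]]
  by (auto simp: rev_path_def[abs_def] intro!: measurable_path_functional[OF assms] borel_measurable_diff
      measurable_component_singleton)

lemma path_functional_nonpos_time: "path_functional (count_space UNIV) nonpos_time"
  unfolding path_functional_def
proof (intro conjI allI horizon_local_nonpos_time)
  fix k :: nat
  have [measurable]: "Measurable.pred (\<Pi>\<^sub>M i\<in>{..k}. borel) (\<lambda>s. i \<in> {1..k} \<and> s i \<le> (0 :: real))" for i
    by (cases "i \<le> k") auto
  show "nonpos_time k \<in> (\<Pi>\<^sub>M i\<in>{..k}. borel) \<rightarrow>\<^sub>M count_space UNIV"
    unfolding nonpos_time_def[abs_def] by (rule measurable_card) simp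
qed

lemma path_functional_last_argmin: "path_functional (count_space UNIV) last_argmin"
  unfolding path_functional_def
proof (intro conjI allI horizon_local_last_argmin)
  fix k :: nat
  have le: "Measurable.pred (\<Pi>\<^sub>M i\<in>{..k}. borel) (\<lambda>s. s i \<le> (s j :: real))"
    if "i \<le> k" "j \<le> k" for i j
  proof -
    have comp: "(\<lambda>s. s l) \<in> borel_measurable (\<Pi>\<^sub>M i\<in>{..k}. borel :: real measure)"
      if "l \<le> k" for l
      using that by (intro measurable_component_singleton) simp
    show ?thesis
      unfolding pred_def using that by (intro borel_measurable_le comp)
  qed
  have pred: "Measurable.pred (\<Pi>\<^sub>M i\<in>{..k}. borel)
      (\<lambda>s. i \<le> k \<and> (\<forall>j\<in>{..k}. s i \<le> (s j :: real)))" for i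
  proof (cases "i \<le> k")
    case True
    have "Measurable.pred (\<Pi>\<^sub>M i\<in>{..k}. borel) (\<lambda>s. \<forall>j\<in>{..k}. s i \<le> (s j :: real))"
      by (rule pred_intros_finite(3)[OF finite_atMost]) (rule le[OF True], simp)
    with True show ?thesis by simp
  qed simp
  have eq: "last_argmin k = (\<lambda>s. Max {i. i \<le> k \<and> (\<forall>j\<in>{..k}. s i \<le> s j)})"
    unfolding last_argmin_def[abs_def] argmin_set_def by (simp add: Ball_def)
  show "last_argmin k \<in> (\<Pi>\<^sub>M i\<in>{..k}. borel) \<rightarrow>\<^sub>M count_space UNIV"
    unfolding eq by (rule measurable_Max_nat[OF pred])
qed

lemma path_functional_path_upto: "path_functional path_space path_upto"
  unfolding path_functional_def
proof (intro conjI allI horizon_local_path_upto)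
  fix k :: nat
  have "(\<lambda>s. restrict s {..k} i) \<in> borel_measurable (\<Pi>\<^sub>M i\<in>{..k}. borel :: real measure)" for i
    by (cases "i \<le> k") auto
  then have [measurable]: "(\<lambda>s. restrict s {..k}) \<in> (\<Pi>\<^sub>M i\<in>{..k}. borel :: real measure) \<rightarrow>\<^sub>M (\<Pi>\<^sub>M i\<in>UNIV. borel)"
    by (intro measurable_PiM_single') auto
  show "path_upto k \<in> (\<Pi>\<^sub>M i\<in>{..k}. borel) \<rightarrow>\<^sub>M path_space"
    unfolding path_upto_def[abs_def] path_space_def by measurable
qed

section \<open>Exchangeable increments\<close>

definition partial_sums :: "(nat \<Rightarrow> real) \<Rightarrow> nat \<Rightarrow> real" where
  "partial_sums x i = (\<Sum>j=1..i. x j)"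

definition exchangeable :: "nat \<Rightarrow> (nat \<Rightarrow> real) measure \<Rightarrow> bool" where
  "exchangeable n P \<longleftrightarrow> sets P = sets (\<Pi>\<^sub>M i\<in>{1..n}. borel) \<and>
    (\<forall>p. p permutes {1..n} \<longrightarrow> distr P P (\<lambda>x. \<lambda>i\<in>{1..n}. x (p i)) = P)"

lemma exchangeable_iid:
  fixes \<zeta> :: "nat \<Rightarrow> 'a \<Rightarrow> real"
  assumes "prob_space M" "prob_space.indep_vars M (\<lambda>_. borel) \<zeta> {1..n}"
    and id: "\<And>i j. i \<in> {1..n} \<Longrightarrow> j \<in> {1..n} \<Longrightarrow> distr M borel (\<zeta> i) = distr M borel (\<zeta> j)"
  shows "exchangeable n (distr M (\<Pi>\<^sub>M i\<in>{1..n}. borel) (\<lambda>\<omega>. \<lambda>i\<in>{1..n}. \<zeta> i \<omega>))"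
    (is "exchangeable n ?P")
  unfolding exchangeable_def
proof (intro conjI allI impI)
  show "sets ?P = sets (\<Pi>\<^sub>M i\<in>{1..n}. borel)" by simp
  interpret prob_space M by fact
  fix p assume p: "p permutes {1..n}"
  show "distr ?P ?P (\<lambda>x. \<lambda>i\<in>{1..n}. x (p i)) = ?P" (is "distr _ _ ?t = _")
    \<comment> \<open>The description of independence by product measures needs a nonempty index set.\<close>
  proof (cases "n = 0")
    case True
    then have "distr ?P ?P ?t = distr ?P ?P (\<lambda>x. x)"
      by (intro distr_cong refl) (auto simp: space_PiM)
    then show ?thesis by (simp add: distr_id)
  next
    case False
    have rv: "random_variable borel (\<zeta> i)" if "i \<in> {1..n}" for i
      using assms(2) that by (simp add: indep_vars_def)
    let ?D = "\<lambda>i. distr M borel (\<zeta> i)"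
    have P: "?P = (\<Pi>\<^sub>M i\<in>{1..n}. ?D i)"
      using False assms(2) rv by (subst indep_vars_iff_distr_eq_PiM'[symmetric]) auto
    have D: "(\<Pi>\<^sub>M i\<in>{1..n}. ?D (p i)) = (\<Pi>\<^sub>M i\<in>{1..n}. ?D i)"
    proof (rule PiM_cong[OF refl])
      fix i assume i: "i \<in> {1..n}"
      then have "p i \<in> {1..n}" using permutes_in_image[OF p] by blast
      then show "?D (p i) = ?D i" using i by (rule id)
    qed
    have "distr (\<Pi>\<^sub>M i\<in>{1..n}. ?D i) (\<Pi>\<^sub>M i\<in>{1..n}. ?D (p i)) ?t = (\<Pi>\<^sub>M i\<in>{1..n}. ?D (p i))"
    proof (rule distr_PiM_reindex)
      show "prob_space (?D i)" if "i \<in> {1..n}" for i using rv[OF that] by (rule prob_space_distr)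
      show "inj_on p {1..n}" "p \<in> {1..n} \<rightarrow> {1..n}"
        using p permutes_inj_on permutes_in_image[OF p] by auto
    qed
    then show ?thesis unfolding P D .
  qed
qed

text \<open>An ordering \<open>ls\<close> of \<open>{1..k}\<close> as a permutation of all indices. List positions start at \<open>0\<close>, times
  of increments at \<open>1\<close>.\<close>
definition order_fun :: "nat list \<Rightarrow> nat \<Rightarrow> nat" where
  "order_fun ls i = (if i \<in> {1..length ls} then ls ! (i - 1) else i)"

lemma order_fun_permutes:
  assumes "ls \<in> permutations_of_set {1..k}"
  shows "order_fun ls permutes {1..k}"
proof (rule bij_imp_permutes)
  have len: "length ls = k" using length_finite_permutations_of_set[OF assms] by simp
  have "bij_betw (\<lambda>i. i - 1) {1..k} {..<k}"
    by (rule bij_betw_byWitness[where f' = Suc]) auto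
  moreover have "bij_betw ((!) ls) {..<k} {1..k}"
    using assms len by (intro bij_betw_nth) (auto simp: permutations_of_set_def)
  ultimately have "bij_betw ((!) ls \<circ> (\<lambda>i. i - 1)) {1..k} {1..k}" by (rule bij_betw_trans)
  then show "bij_betw (order_fun ls) {1..k} {1..k}"
    by (rule iffD1[OF bij_betw_cong, rotated]) (auto simp: order_fun_def len)
  show "order_fun ls i = i" if "i \<notin> {1..k}" for i
    using that unfolding order_fun_def len by (rule if_not_P)
qed

lemma partial_sums_order_fun:
  assumes "i \<le> length ls"
  shows "partial_sums (\<lambda>j. x (order_fun ls j)) i = list_path (map x ls) i"
  using assms
proof (induction i)
  case 0
  show ?case by (simp add: partial_sums_def list_path_def)
next
  case (Suc i)
  then show ?case
    by (simp add: partial_sums_def list_path_def take_Suc_conv_app_nth order_fun_def)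
qed

lemma partial_sums_permutes:
  assumes p: "p permutes {1..k}" and "k \<le> i"
  shows "partial_sums (\<lambda>j. x (p j)) i = partial_sums x i"
proof -
  have "p permutes {1..i}" using assms by (intro permutes_subset[OF p]) auto
  then show ?thesis
    unfolding partial_sums_def using sum.permute[of p "{1..i}" x] by (simp add: o_def)
qed

section \<open>Conditional laws up to the last nonpositive time\<close>

lemma last_nonpos_eq_iff:
  assumes "s 0 \<le> 0"
  shows "last_nonpos n s = k \<longleftrightarrow> k \<le> n \<and> s k \<le> 0 \<and> (\<forall>i\<in>{k<..n}. 0 < s i)"
proof -
  have fin: "finite {i. i \<le> n \<and> s i \<le> 0}" by simp
  have ne: "{i. i \<le> n \<and> s i \<le> 0} \<noteq> {}" using assms by auto
  show ?thesis
    unfolding last_nonpos_def Max_eq_iff[OF fin ne]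
    by (metis (no_types, lifting) greaterThanAtMost_iff mem_Collect_eq not_le)
qed

lemma last_nonpos_le: "s 0 \<le> 0 \<Longrightarrow> last_nonpos n s \<le> n"
  using last_nonpos_eq_iff by blast

lemma partial_sums_0 [simp]: "partial_sums x 0 = 0"
  by (simp add: partial_sums_def)

text \<open>Whether the last nonpositive time is \<open>k\<close> depends only on the values from time \<open>k\<close> on, where a
  permutation of the first \<open>k\<close> increments has no effect.\<close>
lemma last_nonpos_permutes:
  assumes p: "p permutes {1..k}"
  shows "last_nonpos n (partial_sums (\<lambda>j. x (p j))) = k \<longleftrightarrow> last_nonpos n (partial_sums x) = k"
  by (simp add: last_nonpos_eq_iff partial_sums_permutes[OF p])

lemma measurable_partial_sums:
  assumes "sets P = sets (\<Pi>\<^sub>M i\<in>{1..n}. borel)" "i \<le> n"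
  shows "(\<lambda>x. partial_sums x i) \<in> borel_measurable P"
  unfolding partial_sums_def measurable_cong_sets[OF assms(1) refl]
  using assms(2) by (intro borel_measurable_sum measurable_component_singleton) auto

lemma measurable_last_nonpos:
  assumes [measurable]: "\<And>i. i \<le> n \<Longrightarrow> (\<lambda>x. s x i) \<in> borel_measurable P"
  shows "(\<lambda>x. last_nonpos n (s x)) \<in> P \<rightarrow>\<^sub>M count_space UNIV"
proof -
  have [measurable]: "Measurable.pred P (\<lambda>x. i \<le> n \<and> s x i \<le> 0)" for i
    by (cases "i \<le> n") auto
  show ?thesis unfolding last_nonpos_def by measurable
qed

text \<open>The random horizon takes countably many values, so measurability can be checked at each of them.\<close>
lemma measurable_at_last_nonpos:
  assumes sets: "sets P = sets (\<Pi>\<^sub>M i\<in>{1..n}. borel)"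
    and f: "path_functional N f"
  shows "(\<lambda>x. f (last_nonpos n (partial_sums x)) (partial_sums x)) \<in> P \<rightarrow>\<^sub>M N"
proof -
  \<comment> \<open>The horizon is at most \<open>n\<close>; truncating it makes this visible for every value it might take.\<close>
  have "(\<lambda>x. f (min n (last_nonpos n (partial_sums x))) (partial_sums x)) \<in> P \<rightarrow>\<^sub>M N"
    by (rule measurable_compose_countable[where f = "\<lambda>k x. f (min n k) (partial_sums x)"])
      (auto intro!: measurable_path_functional[OF f] measurable_last_nonpos
        measurable_partial_sums[OF sets])
  then show ?thesis by (simp add: min_absorb2 last_nonpos_le)
qed

text \<open>Exchangeability survives on the event \<open>G\<close>: the permutation of increments given by \<open>ls\<close> preserves \<open>P\<close>
  and \<open>G\<close>, and turns the path up to \<open>k\<close> into the path of the reordered increments.\<close>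
lemma emeasure_reorder_up_to_last_nonpos:
  assumes ex: "exchangeable n P" and k: "k \<le> n" and B: "B \<in> sets borel"
    and f: "path_functional N f" and A: "A \<in> sets N"
    and ls: "ls \<in> permutations_of_set {1..k}"
  defines "G \<equiv> (\<lambda>x. last_nonpos n (partial_sums x) = k \<and> partial_sums x n \<in> B)"
  shows "{x \<in> space P. G x \<and> f k (list_path (map x ls)) \<in> A} \<in> sets P" (is "?R \<in> _")
    and "emeasure P {x \<in> space P. G x \<and> f k (list_path (map x ls)) \<in> A} =
      emeasure P {x \<in> space P. G x \<and> f k (partial_sums x) \<in> A}" (is "_ = emeasure P ?S")
proof -
  let ?p = "order_fun ls"
  let ?t = "\<lambda>x. \<lambda>i\<in>{1..n}. x (?p i)"
  have sets: "sets P = sets (\<Pi>\<^sub>M i\<in>{1..n}. borel)" and space: "space P = extensional {1..n}"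
    using ex by (auto simp: exchangeable_def space_PiM PiE_def dest: sets_eq_imp_space_eq)
  have [measurable]: "(\<lambda>x. f k (partial_sums x)) \<in> P \<rightarrow>\<^sub>M N"
    using k by (intro measurable_path_functional[OF f] measurable_partial_sums[OF sets]) auto
  note [measurable] = measurable_partial_sums[OF sets order.refl] A B
    measurable_last_nonpos[OF measurable_partial_sums[OF sets]]
  have S: "?S \<in> sets P" unfolding G_def by measurable
  have len: "length ls = k" using length_finite_permutations_of_set[OF ls] by simp
  have pk: "?p permutes {1..k}" by (rule order_fun_permutes[OF ls])
  then have pn: "?p permutes {1..n}" by (rule permutes_subset) (use k in auto)
  have t: "?t \<in> P \<rightarrow>\<^sub>M P"
    unfolding measurable_cong_sets[OF sets sets]
    using permutes_in_image[OF pn]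
    by (intro measurable_restrict measurable_component_singleton) blast
  have sums: "partial_sums (?t x) i = partial_sums (\<lambda>j. x (?p j)) i" if "i \<le> n" for x i
    unfolding partial_sums_def using that by (intro sum.cong) auto
  have "G (?t x) \<longleftrightarrow> G x" for x
  proof -
    have "last_nonpos n (partial_sums (?t x)) = last_nonpos n (partial_sums (\<lambda>j. x (?p j)))"
      unfolding last_nonpos_def using sums by (metis (lifting))
    then show ?thesis
      unfolding G_def using last_nonpos_permutes[OF pk] sums partial_sums_permutes[OF pk k] by simp
  qed
  moreover have "f k (partial_sums (?t x)) = f k (list_path (map x ls))" for x
    using k len by (intro horizon_localD[OF path_functional_local[OF f]]) (subst sums, simp_all add: partial_sums_order_fun)
  ultimately have pre: "?t -` ?S \<inter> space P = ?R"
    using measurable_space[OF t] by auto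
  show "?R \<in> sets P" unfolding pre[symmetric] by (rule measurable_sets[OF t S])
  have "emeasure P ?S = emeasure (distr P P ?t) ?S"
    using ex pn by (simp add: exchangeable_def)
  also have "\<dots> = emeasure P ?R" unfolding emeasure_distr[OF t S] pre ..
  finally show "emeasure P ?R = emeasure P ?S" ..
qed

text \<open>Averaging over the \<open>k!\<close> orderings, which all have the same weight by the preceding lemma, replaces
  the indicator of \<open>f k \<in> A\<close> by the number of orderings for which it holds. That number is the
  same for \<open>f\<close> and \<open>g\<close> at each vector of increments.\<close>
lemma emeasure_eq_if_equally_often:
  fixes f g :: "nat \<Rightarrow> (nat \<Rightarrow> real) \<Rightarrow> 'b"
  assumes ex: "exchangeable n P" and k: "k \<le> n" and B: "B \<in> sets borel"
    and f: "path_functional N f" and g: "path_functional N g"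
    and A: "A \<in> sets N" and fg: "equally_often f g"
  defines "G \<equiv> (\<lambda>x. last_nonpos n (partial_sums x) = k \<and> partial_sums x n \<in> B)"
  shows "emeasure P {x \<in> space P. G x \<and> f k (partial_sums x) \<in> A} =
    emeasure P {x \<in> space P. G x \<and> g k (partial_sums x) \<in> A}"
proof -
  let ?L = "permutations_of_set {1..k}"
  let ?c = "\<lambda>h x. card {ls \<in> ?L. h k (list_path (map x ls)) \<in> A}"
  have average: "fact k * emeasure P {x \<in> space P. G x \<and> h k (partial_sums x) \<in> A} =
      (\<integral>\<^sup>+x. (if G x then of_nat (?c h x) else 0) \<partial>P)"
    if h: "path_functional N h" for h
  proof -
    let ?R = "\<lambda>ls. {x \<in> space P. G x \<and> h k (list_path (map x ls)) \<in> A}"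
    have reorder: "?R ls \<in> sets P"
      "emeasure P (?R ls) = emeasure P {x \<in> space P. G x \<and> h k (partial_sums x) \<in> A}"
      if "ls \<in> ?L" for ls
      unfolding G_def
      using emeasure_reorder_up_to_last_nonpos[OF ex k B h A that] by blast+
    have "fact k * emeasure P {x \<in> space P. G x \<and> h k (partial_sums x) \<in> A} =
        (\<Sum>ls\<in>?L. emeasure P (?R ls))"
      using reorder(2) by simp
    also have "\<dots> = (\<Sum>ls\<in>?L. \<integral>\<^sup>+x. indicator (?R ls) x \<partial>P)"
      using reorder(1) by simp
    also have "\<dots> = (\<integral>\<^sup>+x. (\<Sum>ls\<in>?L. indicator (?R ls) x) \<partial>P)"
      using reorder(1) by (intro nn_integral_sum[symmetric]) auto
    also have "\<dots> = (\<integral>\<^sup>+x. (if G x then of_nat (?c h x) else 0) \<partial>P)"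
    proof (rule nn_integral_cong)
      fix x assume x: "x \<in> space P"
      have "(\<Sum>ls\<in>?L. indicator (?R ls) x :: ennreal) =
          (if G x then \<Sum>ls\<in>?L. of_bool (h k (list_path (map x ls)) \<in> A) else 0)"
        using x by (auto simp: indicator_def intro!: sum.cong)
      then show "(\<Sum>ls\<in>?L. indicator (?R ls) x :: ennreal) =
          (if G x then of_nat (?c h x) else 0)"
        by (simp add: sum_of_bool_eq Int_def)
    qed
    finally show ?thesis .
  qed
  have count: "?c f x = ?c g x" for x
    using fg unfolding equally_often_def by blast
  have "fact k * emeasure P {x \<in> space P. G x \<and> f k (partial_sums x) \<in> A} =
      fact k * emeasure P {x \<in> space P. G x \<and> g k (partial_sums x) \<in> A}"
    unfolding average[OF f] average[OF g] count ..
  moreover have "(of_nat (fact k) :: ennreal) \<noteq> 0" "(of_nat (fact k) :: ennreal) \<noteq> \<top>"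
    by (simp_all del: of_nat_fact)
  ultimately show ?thesis
    unfolding of_nat_fact by (simp only: ennreal_mult_cancel_left) blast
qed

text \<open>The event that the path ends in \<open>B\<close> is split according to the value of the last nonpositive time.\<close>
lemma conditional_law_eq:
  fixes f g :: "nat \<Rightarrow> (nat \<Rightarrow> real) \<Rightarrow> 'b"
  assumes ex: "exchangeable n P" and B: "B \<in> sets borel"
    and f: "path_functional N f" and g: "path_functional N g"
    and fg: "equally_often f g"
  defines "Q \<equiv> uniform_measure P {x \<in> space P. partial_sums x n \<in> B}"
  shows "distr Q N (\<lambda>x. f (last_nonpos n (partial_sums x)) (partial_sums x)) =
    distr Q N (\<lambda>x. g (last_nonpos n (partial_sums x)) (partial_sums x))"
proof (rule measure_eqI)
  fix A assume "A \<in> sets (distr Q N (\<lambda>x. f (last_nonpos n (partial_sums x)) (partial_sums x)))"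
  then have A: "A \<in> sets N" by simp
  have sets: "sets P = sets (\<Pi>\<^sub>M i\<in>{1..n}. borel)" using ex by (simp add: exchangeable_def)
  note [measurable] = measurable_partial_sums[OF sets order.refl] A B
    measurable_last_nonpos[OF measurable_partial_sums[OF sets]]
  let ?\<sigma> = "\<lambda>x. last_nonpos n (partial_sums x)"
  let ?E = "{x \<in> space P. partial_sums x n \<in> B}"
  have E: "?E \<in> sets P" by measurable
  have split: "emeasure (distr Q N (\<lambda>x. h (?\<sigma> x) (partial_sums x))) A =
      (\<Sum>k\<le>n. emeasure P {x \<in> space P. (?\<sigma> x = k \<and> partial_sums x n \<in> B) \<and>
        h k (partial_sums x) \<in> A}) / emeasure P ?E"
    if h: "path_functional N h" for h
  proof -
    let ?U = "\<lambda>x. h (?\<sigma> x) (partial_sums x)"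
    have U: "?U \<in> P \<rightarrow>\<^sub>M N" by (rule measurable_at_last_nonpos[OF sets h])
    let ?S = "\<lambda>k. {x \<in> space P. (?\<sigma> x = k \<and> partial_sums x n \<in> B) \<and> h k (partial_sums x) \<in> A}"
    have S: "?S k \<in> sets P" if "k \<le> n" for k
    proof -
      have [measurable]: "(\<lambda>x. h k (partial_sums x)) \<in> P \<rightarrow>\<^sub>M N"
        using that by (intro measurable_path_functional[OF h] measurable_partial_sums[OF sets]) auto
      show ?thesis by measurable
    qed
    have "?U \<in> Q \<rightarrow>\<^sub>M N"
      unfolding Q_def measurable_cong_sets[OF sets_uniform_measure refl] by (rule U)
    then have "emeasure (distr Q N ?U) A = emeasure Q (?U -` A \<inter> space Q)"
      using A by (rule emeasure_distr)
    also have "space Q = space P" by (simp add: Q_def)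
    also have "emeasure Q (?U -` A \<inter> space P) =
        emeasure P (?E \<inter> (?U -` A \<inter> space P)) / emeasure P ?E"
      unfolding Q_def by (rule emeasure_uniform_measure[OF E measurable_sets[OF U A]])
    also have "?E \<inter> (?U -` A \<inter> space P) = (\<Union>k\<le>n. ?S k)"
      using last_nonpos_le[of "partial_sums _" n] by auto
    also have "emeasure P (\<Union>k\<le>n. ?S k) = (\<Sum>k\<le>n. emeasure P (?S k))"
    proof (rule sum_emeasure[symmetric])
      show "?S ` {..n} \<subseteq> sets P" using S by blast
      show "disjoint_family_on ?S {..n}" unfolding disjoint_family_on_def by blast
    qed simp
    finally show ?thesis .
  qed
  show "emeasure (distr Q N (\<lambda>x. f (?\<sigma> x) (partial_sums x))) A =
      emeasure (distr Q N (\<lambda>x. g (?\<sigma> x) (partial_sums x))) A"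
    unfolding split[of f, OF f] split[of g, OF g]
    by (intro arg_cong2[where f = "(/)"] sum.cong refl
        emeasure_eq_if_equally_often[OF ex _ B f g A fg]) auto
qed simp


section \<open>The random walk conditioned on its endpoint\<close>

lemma distr_uniform_measure:
  assumes X: "X \<in> M \<rightarrow>\<^sub>M N" and E: "E \<in> sets N"
  shows "distr (uniform_measure M (X -` E \<inter> space M)) N X = uniform_measure (distr M N X) E"
proof (rule measure_eqI)
  fix A assume "A \<in> sets (distr (uniform_measure M (X -` E \<inter> space M)) N X)"
  then have A: "A \<in> sets N" by simp
  have "(X -` E \<inter> space M) \<inter> (X -` A \<inter> space M) = X -` (E \<inter> A) \<inter> space M" by auto
  then show "emeasure (distr (uniform_measure M (X -` E \<inter> space M)) N X) A =
      emeasure (uniform_measure (distr M N X) E) A"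
    using A E X by (simp add: emeasure_distr measurable_sets)
qed simp

text \<open>Transfer to a walk on an arbitrary space: the functionals see only the vector of the first \<open>n\<close>
  increments.\<close>
lemma conditional_law_walk_eq:
  fixes f g :: "nat \<Rightarrow> (nat \<Rightarrow> real) \<Rightarrow> 'b" and M :: "'a measure"
  assumes ex: "exchangeable n (distr M (\<Pi>\<^sub>M i\<in>{1..n}. borel) (\<lambda>\<omega>. \<lambda>i\<in>{1..n}. \<zeta> i \<omega>))"
    and \<zeta>: "\<forall>i\<in>{1..n}. \<zeta> i \<in> borel_measurable M" and B: "B \<in> sets borel"
    and f: "path_functional N f" and g: "path_functional N g" and fg: "equally_often f g"
  defines "Q \<equiv> uniform_measure M {\<omega> \<in> space M. walk \<zeta> \<omega> n \<in> B}"
  shows "distr Q N (\<lambda>\<omega>. f (last_nonpos n (walk \<zeta> \<omega>)) (walk \<zeta> \<omega>)) =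
    distr Q N (\<lambda>\<omega>. g (last_nonpos n (walk \<zeta> \<omega>)) (walk \<zeta> \<omega>))"
proof -
  let ?I = "\<Pi>\<^sub>M i\<in>{1..n}. borel :: real measure"
  let ?X = "\<lambda>\<omega>. \<lambda>i\<in>{1..n}. \<zeta> i \<omega>"
  let ?P = "distr M ?I ?X"
  let ?E = "{x \<in> space ?P. partial_sums x n \<in> B}"
  have sets: "sets ?P = sets ?I" by simp
  have X: "?X \<in> M \<rightarrow>\<^sub>M ?I" using \<zeta> by (intro measurable_restrict) blast
  have E: "?E \<in> sets ?I"
    using measurable_sets[OF measurable_partial_sums[OF sets order.refl] B]
    by (simp add: vimage_def Int_def conj_commute)
  have walk: "partial_sums (?X \<omega>) i = walk \<zeta> \<omega> i" if "i \<le> n" for i \<omega>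
    unfolding partial_sums_def walk_def using that by (intro sum.cong) auto
  have "{\<omega> \<in> space M. walk \<zeta> \<omega> n \<in> B} = ?X -` ?E \<inter> space M"
    using measurable_space[OF X] walk by auto
  then have Q: "distr Q ?I ?X = uniform_measure ?P ?E"
    unfolding Q_def by (simp only: distr_uniform_measure[OF X E])
  have transfer: "distr Q N (\<lambda>\<omega>. h (last_nonpos n (walk \<zeta> \<omega>)) (walk \<zeta> \<omega>)) =
      distr (uniform_measure ?P ?E) N (\<lambda>x. h (last_nonpos n (partial_sums x)) (partial_sums x))"
    if h: "path_functional N h" for h
  proof -
    have "h (last_nonpos n (partial_sums (?X \<omega>))) (partial_sums (?X \<omega>)) =
        h (last_nonpos n (walk \<zeta> \<omega>)) (walk \<zeta> \<omega>)" for \<omega>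
    proof -
      have same: "last_nonpos n (partial_sums (?X \<omega>)) = last_nonpos n (walk \<zeta> \<omega>)"
        unfolding last_nonpos_def using walk by (metis (lifting))
      have "last_nonpos n (walk \<zeta> \<omega>) \<le> n" by (rule last_nonpos_le) (simp add: walk_def)
      then show ?thesis
        unfolding same by (intro horizon_localD[OF path_functional_local[OF h]] walk) simp
    qed
    moreover have "?X \<in> Q \<rightarrow>\<^sub>M ?I" using X unfolding Q_def by simp
    moreover have "(\<lambda>x. h (last_nonpos n (partial_sums x)) (partial_sums x)) \<in> ?I \<rightarrow>\<^sub>M N"
      using measurable_at_last_nonpos[OF refl h] .
    ultimately show ?thesis unfolding Q[symmetric] by (subst distr_distr) (auto simp: o_def)
  qed
  show ?thesis
    unfolding transfer[OF f] transfer[OF g] by (rule conditional_law_eq[OF ex B f g fg])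
qed

theorem proposition3p1:
  fixes M :: "'a measure" and \<zeta> :: "nat \<Rightarrow> 'a \<Rightarrow> real" and n :: nat and B :: "real set"
  assumes "prob_space M"
    and "prob_space.indep_vars M (\<lambda>_. borel) \<zeta> {1..n}"
    and "\<forall>i\<in>{1..n}. \<forall>j\<in>{1..n}. distr M borel (\<zeta> i) = distr M borel (\<zeta> j)"
    and "B \<in> sets borel"
    and "measure M {\<omega> \<in> space M. walk \<zeta> \<omega> n \<in> B} > 0"
  shows
    "let Q = uniform_measure M {\<omega> \<in> space M. walk \<zeta> \<omega> n \<in> B};
         S = walk \<zeta>;
         \<sigma> = (\<lambda>\<omega>. last_nonpos n (S \<omega>));
         law = (\<lambda>X. distr Q (count_space UNIV) (\<lambda>\<omega>. X n (S \<omega>)))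
     in distr Q path_space (\<lambda>\<omega>. path_upto (\<sigma> \<omega>) (reversed n (S \<omega>)))
          = distr Q path_space (\<lambda>\<omega>. path_upto (\<sigma> \<omega>) (S \<omega>))
      \<and> (law N_minus = law Nt_plus \<and> law Nt_plus = law F_right \<and> law F_right = law G_left)
      \<and> (law N_plus = law Nt_minus \<and> law Nt_minus = law F_left \<and> law F_left = law G_right)"
proof -
  interpret prob_space M by fact
  have ex: "exchangeable n (distr M (\<Pi>\<^sub>M i\<in>{1..n}. borel) (\<lambda>\<omega>. \<lambda>i\<in>{1..n}. \<zeta> i \<omega>))"
    using assms(3) by (intro exchangeable_iid[OF assms(1,2)]) blast
  have \<zeta>: "\<forall>i\<in>{1..n}. \<zeta> i \<in> borel_measurable M"
    using assms(2) by (simp add: indep_vars_def)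
  note law_eq = conditional_law_walk_eq[OF ex \<zeta> assms(4)]
  note time = path_functional_nonpos_time and argmin = path_functional_last_argmin
  note sparre_andersen = equally_often_nonpos_time_last_argmin
  have rev_time: "equally_often (\<lambda>k s. nonpos_time k (rev_path k s)) nonpos_time"
    by (rule equally_often_rev_path[OF horizon_local_nonpos_time])
  have rev_argmin: "equally_often (\<lambda>k s. last_argmin k (rev_path k s)) last_argmin"
    by (rule equally_often_rev_path[OF horizon_local_last_argmin])
  \<comment> \<open>Negation and reversal commute, so the third claim is the second one for the negated
    functionals at the same horizon. The walk itself is not negated, as this would change
    the last nonpositive time.\<close>
  have neg_rev: "(\<lambda>i. - rev_path k s i) = rev_path k (\<lambda>i. - s i)" for k s
    by (simp add: rev_path_def fun_eq_iff)
  have 1: "distr (uniform_measure M {\<omega> \<in> space M. walk \<zeta> \<omega> n \<in> B}) path_space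
        (\<lambda>\<omega>. path_upto (last_nonpos n (walk \<zeta> \<omega>)) (reversed n (walk \<zeta> \<omega>))) =
      distr (uniform_measure M {\<omega> \<in> space M. walk \<zeta> \<omega> n \<in> B}) path_space
        (\<lambda>\<omega>. path_upto (last_nonpos n (walk \<zeta> \<omega>)) (walk \<zeta> \<omega>))"
  proof -
    have "reversed n s = rev_path (last_nonpos n s) s" for s
      by (simp add: reversed_def rev_path_def fun_eq_iff)
    then show ?thesis
      using law_eq[OF path_functional_rev_path[OF path_functional_path_upto]
          path_functional_path_upto equally_often_rev_path[OF horizon_local_path_upto]]
      by simp
  qed
  have time_time_rev: "equally_often nonpos_time (\<lambda>k s. nonpos_time k (rev_path k s))"
    by (rule equally_often_sym[OF rev_time])
  have time_rev_argmin: "equally_often (\<lambda>k s. nonpos_time k (rev_path k s)) last_argmin"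
    by (rule equally_often_trans[OF rev_time sparre_andersen])
  have argmin_argmin_rev: "equally_often last_argmin (\<lambda>k s. last_argmin k (rev_path k s))"
    by (rule equally_often_sym[OF rev_argmin])
  have time_rev_argmin_rev: "equally_often (\<lambda>k s. nonpos_time k (rev_path k s))
      (\<lambda>k s. last_argmin k (rev_path k s))"
    by (rule equally_often_trans[OF time_rev_argmin argmin_argmin_rev])
  note time_rev_pf = path_functional_rev_path[OF time]
    and argmin_rev_pf = path_functional_rev_path[OF argmin]
  note neg = path_functional_uminus
  show ?thesis
    unfolding Let_def functionals_at_last_nonpos neg_rev
    by (intro conjI 1
        law_eq[OF time time_rev_pf time_time_rev]
        law_eq[OF time_rev_pf argmin time_rev_argmin]
        law_eq[OF argmin argmin_rev_pf argmin_argmin_rev]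
        law_eq[OF neg[OF time] neg[OF time_rev_pf] equally_often_uminus[OF time_time_rev]]
        law_eq[OF neg[OF time_rev_pf] neg[OF argmin_rev_pf] equally_often_uminus[OF time_rev_argmin_rev]]
        law_eq[OF neg[OF argmin_rev_pf] neg[OF argmin] equally_often_uminus[OF rev_argmin]])
qed

end
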